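(* For every positive real number $\eta<1$, every integer $t\ge 1$ and every prime $p$, there exists a finite group $G$ such that $O_p(G)=1$ and $|\Lambda_{G,p}(x)|\ge \eta|G|$ for some element $x\in G$ of order $p^t$.
   Context: For a finite group $G$, a prime $p$ and a $p$-element $x\in G$, $\Lambda_{G,p}(x)=\{g\in G : \langle x,x^g\rangle \text{ is a } p\text{-group}\}$, where $x^g=g^{-1}xg$. $O_p(G)$ is the largest normal $p$-subgroup of $G$. *)

theory Defs
  imports "HOL-Algebra.Algebra" "HOL-Computational_Algebra.Primes"
begin

definition p_group :: "nat \<Rightarrow> ('a, 'b) monoid_scheme \<Rightarrow> bool" where
  "p_group p G \<longleftrightarrow> group G \<and> (\<exists>k. order G = p ^ k)"

definition normal_p_subgroup :: "nat \<Rightarrow> 'a set \<Rightarrow> ('a, 'b) monoid_scheme \<Rightarrow> bool" where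
  "normal_p_subgroup p P G \<longleftrightarrow> P \<lhd> G \<and> p_group p (G\<lparr>carrier := P\<rparr>)"

text \<open>The greatest normal \<open>p\<close>-subgroup with respect to inclusion; for finite \<open>G\<close> and
  prime \<open>p\<close> it exists by \<open>p_core_greatest\<close> below.\<close>

definition p_core :: "nat \<Rightarrow> ('a, 'b) monoid_scheme \<Rightarrow> 'a set" where
  "p_core p G = (GREATEST P. normal_p_subgroup p P G)"

definition conj_by :: "('a, 'b) monoid_scheme \<Rightarrow> 'a \<Rightarrow> 'a \<Rightarrow> 'a" where
  "conj_by G x g = inv\<^bsub>G\<^esub> g \<otimes>\<^bsub>G\<^esub> x \<otimes>\<^bsub>G\<^esub> g"

definition Lambda :: "('a, 'b) monoid_scheme \<Rightarrow> nat \<Rightarrow> 'a \<Rightarrow> 'a set" where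
  "Lambda G p x = {g \<in> carrier G. p_group p (subgroup_generated G {x, conj_by G x g})}"

lemma normal_p_subgroup_set_mult:
  assumes "group G" "finite (carrier G)" "Factorial_Ring.prime p"
    and P: "normal_p_subgroup p P G" and Q: "normal_p_subgroup p Q G"
  shows "normal_p_subgroup p (P <#>\<^bsub>G\<^esub> Q) G"
proof -
  interpret group G by fact
  let ?PQ = "P <#>\<^bsub>G\<^esub> Q"
  have nP: "P \<lhd> G" and nQ: "Q \<lhd> G"
    using P Q by (auto simp: normal_p_subgroup_def)
  have sP: "subgroup P G" and sQ: "subgroup Q G"
    using nP nQ normal_imp_subgroup by auto
  obtain i j where ij: "card P = p ^ i" "card Q = p ^ j"
    using P Q by (auto simp: normal_p_subgroup_def p_group_def order_def)
  have nPQ: "?PQ \<lhd> G"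
    by (rule normal_subgroup_set_mult_closed[OF nP nQ])
  then have sPQ: "subgroup ?PQ G" by (rule normal_imp_subgroup)
  interpret PQ: group "G\<lparr>carrier := ?PQ\<rparr>" by (rule subgroup_imp_group[OF sPQ])
  interpret Q: group "G\<lparr>carrier := Q\<rparr>" by (rule subgroup_imp_group[OF sQ])
  have "P \<lhd> G\<lparr>carrier := ?PQ\<rparr>"
    by (rule normal_in_normal_set_mult[OF nP sQ])
  then have 1: "card (rcosets\<^bsub>G\<lparr>carrier := ?PQ\<rparr>\<^esub> P) * card P = card ?PQ"
    using PQ.lagrange[OF normal_imp_subgroup] by (simp add: order_def)
  have "P \<inter> Q \<lhd> G\<lparr>carrier := Q\<rparr>"
    using normal_Int_subgroup[OF sQ nP] by (simp add: Int_commute)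
  then have 2: "card (rcosets\<^bsub>G\<lparr>carrier := Q\<rparr>\<^esub> (P \<inter> Q)) * card (P \<inter> Q) = card Q"
    using Q.lagrange[OF normal_imp_subgroup] by (simp add: order_def)
  have "card (rcosets\<^bsub>G\<lparr>carrier := ?PQ\<rparr>\<^esub> P) = card (rcosets\<^bsub>G\<lparr>carrier := Q\<rparr>\<^esub> (P \<inter> Q))"
    using iso_same_card[OF weak_snd_iso_thme[OF sQ nP]] by (simp add: FactGroup_def)
  then have "card ?PQ * card (P \<inter> Q) = p ^ (i + j)"
    unfolding 1[symmetric] power_add ij[symmetric] 2[symmetric] by (simp only: mult_ac)
  then have "card ?PQ dvd p ^ (i + j)"
    by (metis dvd_triv_left)
  then obtain k where "card ?PQ = p ^ k"
    using assms(3) by (auto simp: divides_primepow_nat)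
  then show ?thesis
    using nPQ PQ.group_axioms by (auto simp: normal_p_subgroup_def p_group_def order_def)
qed

lemma p_core_greatest:
  assumes G: "group G" "finite (carrier G)" and p: "Factorial_Ring.prime p"
  shows "normal_p_subgroup p (p_core p G) G"
    and "normal_p_subgroup p Q G \<Longrightarrow> Q \<subseteq> p_core p G"
proof -
  interpret group G by fact
  have sub: "P \<subseteq> carrier G" if "normal_p_subgroup p P G" for P
    using that unfolding normal_p_subgroup_def by (meson normal_imp_subgroup subgroup.subset)
  have one: "normal_p_subgroup p {\<one>\<^bsub>G\<^esub>} G"
    unfolding normal_p_subgroup_def p_group_def
    using one_is_normal subgroup_imp_group[OF triv_subgroup]
    by (simp add: order_def exI[of _ 0])
  have bound: "\<forall>P. normal_p_subgroup p P G \<longrightarrow> card P < Suc (card (carrier G))"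
    using sub card_mono[OF G(2)] by (simp add: less_Suc_eq_le)
  obtain P where P: "normal_p_subgroup p P G"
    and max: "\<And>Q. normal_p_subgroup p Q G \<Longrightarrow> card Q \<le> card P"
    using ex_has_greatest_nat[where P = "\<lambda>P. normal_p_subgroup p P G" and f = card, OF one bound]
    by (elim exE conjE) simp
  have le: "Q \<subseteq> P" if Q: "normal_p_subgroup p Q G" for Q
  proof -
    let ?PQ = "P <#>\<^bsub>G\<^esub> Q"
    have PQ: "normal_p_subgroup p ?PQ G"
      by (rule normal_p_subgroup_set_mult[OF G p P Q])
    have "second_isomorphism_grp P G Q"
      using P Q by (simp add: normal_p_subgroup_def second_isomorphism_grp_def
          second_isomorphism_grp_axioms_def normal_imp_subgroup)
    then have "P \<subseteq> ?PQ" "Q \<subseteq> ?PQ"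
      by (simp_all add: second_isomorphism_grp.H_contained_in_set_mult
          second_isomorphism_grp.S_contained_in_set_mult)
    moreover have "finite ?PQ" by (rule finite_subset[OF sub[OF PQ] G(2)])
    ultimately have "P = ?PQ" using card_seteq[of ?PQ P] max[OF PQ] by simp
    then show ?thesis using \<open>Q \<subseteq> ?PQ\<close> by simp
  qed
  have "p_core p G = P"
    unfolding p_core_def by (rule Greatest_equality) (fact P, fact le)
  then show "normal_p_subgroup p (p_core p G) G"
    and "normal_p_subgroup p Q G \<Longrightarrow> Q \<subseteq> p_core p G"
    using P le by simp_all
qed

end

theory Submission
  imports Defs
begin

text \<open>The group is a symmetric group of large degree \<open>n \<equiv> 1 (mod p)\<close> and \<open>x\<close> is a cycle of length
  \<open>q = p\<^sup>t\<close>; since \<open>q\<close> is fixed while \<open>n\<close> grows, a random conjugate of \<open>x\<close> is almost surely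
  disjoint from \<open>x\<close>.

  If \<open>g\<close> sends no point of the support of \<open>x\<close> into that support, then \<open>x\<close> and \<open>x\<^sup>g\<close> have
  disjoint supports, so they commute, and two commuting \<open>p\<close>-elements generate a \<open>p\<close>-group
  (\<open>support_moved_off_in_Lambda\<close>). The remaining \<open>g\<close> satisfy \<open>g i = j\<close> for one of the \<open>q\<^sup>2\<close>
  pairs of points \<open>i, j\<close> of the support. By transitivity and the orbit-stabilizer theorem, each
  such condition holds for exactly \<open>\<bar>G\<bar> / n\<close> elements, so at most \<open>q\<^sup>2 \<bar>G\<bar> / n\<close> elements lie
  outside \<open>\<Lambda>\<close> (\<open>card_outside_Lambda\<close>), a share of at most \<open>1 - \<eta>\<close> once \<open>n \<ge> q\<^sup>2 / (1 - \<eta>)\<close>.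

  The congruence on \<open>n\<close> makes \<open>O\<^sub>p(G) = 1\<close> immediate (\<open>p_core_trivial\<close>): a \<open>p\<close>-group acting on a
  set whose size is prime to \<open>p\<close> fixes a point, and a normal subgroup of a transitive group that
  fixes one point fixes all of them.

  Both arguments use only that the action is faithful and transitive, and they are stated in
  this generality. The symmetric group enters only as a transitive group of prescribed degree that
  contains a short cycle.\<close>

section \<open>Group actions of \<open>p\<close>-groups\<close>

text \<open>Every orbit has \<open>p\<close>-power size. If none were a singleton, \<open>p\<close> would divide the size of
  each orbit, hence the size of \<open>E\<close>.\<close>

lemma (in group_action) p_group_fixed_point:
  assumes "Factorial_Ring.prime p" and "p_group p G" and "finite E" and "\<not> p dvd card E"
  shows "\<exists>i\<in>E. \<forall>g\<in>carrier G. \<phi> g i = i"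
proof -
  obtain k where k: "order G = p ^ k"
    using assms(2) by (auto simp: p_group_def)
  have "card E = (\<Sum>orb\<in>orbits G E \<phi>. card orb)"
    using disjoint_sum[OF assms(3), of "\<lambda>_. 1::nat"] by simp
  with assms(4) obtain orb where orb: "orb \<in> orbits G E \<phi>" "\<not> p dvd card orb"
    by (metis dvd_sum)
  then obtain i where i: "i \<in> E" "orb = orbit G \<phi> i"
    by (auto simp: orbits_def)
  have "card orb dvd p ^ k"
    using orbit_stabilizer_theorem[OF i(1)] k i(2) by (metis dvd_triv_left)
  then obtain j where "card orb = p ^ j"
    using assms(1) by (auto simp: divides_primepow_nat)
  then have "card orb = 1"
    using orb(2) by (cases j) auto
  then have "orb = {i}"
    using orbit_refl[OF i(1)] i(2) by (metis card_1_singletonE singletonD)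
  then show ?thesis
    using i by (auto simp: orbit_def)
qed

lemma (in group_action) action_one [simp]: "i \<in> E \<Longrightarrow> \<phi> \<one> i = i"
  using id_eq_one by (metis restrict_apply')

lemma (in group_action) action_closed [simp]: "g \<in> carrier G \<Longrightarrow> i \<in> E \<Longrightarrow> \<phi> g i \<in> E"
  using element_image by blast

lemma (in faithful_action) eq_by_action:
  assumes "g \<in> carrier G" and "h \<in> carrier G" and "\<And>i. i \<in> E \<Longrightarrow> \<phi> g i = \<phi> h i"
  shows "g = h"
proof -
  have "\<phi> g = \<phi> h"
    using bij_prop0[OF assms(1)] bij_prop0[OF assms(2)] assms(3)
    by (auto simp: Bij_def intro: extensionalityI)
  then show ?thesis
    using faithful assms(1,2) by (auto dest: inj_onD)
qed

locale faithful_transitive_action = faithful_action + transitive_action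

text \<open>The fixed points of a normal subgroup form a set that is invariant under the whole group, so
  by transitivity the fixed point found by \<open>p_group_fixed_point\<close> makes the \<open>p\<close>-core act
  trivially.\<close>

lemma (in faithful_transitive_action) p_core_trivial:
  assumes p: "Factorial_Ring.prime p" and G: "finite (carrier G)"
    and E: "finite E" "\<not> p dvd card E"
  shows "p_core p G = {\<one>}"
proof -
  interpret group G
    using group_hom group_hom.axioms(1) by blast
  let ?P = "p_core p G"
  have P: "?P \<lhd> G" "p_group p (G\<lparr>carrier := ?P\<rparr>)"
    using p_core_greatest(1)[OF is_group G p] by (auto simp: normal_p_subgroup_def)
  interpret P: normal ?P G by (rule P(1))
  interpret PE: group_action "G\<lparr>carrier := ?P\<rparr>" E \<phi>
    by (rule induced_action[OF P.is_subgroup])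
  obtain i where i: "i \<in> E" "\<And>n. n \<in> ?P \<Longrightarrow> \<phi> n i = i"
    using PE.p_group_fixed_point[OF p P(2) E] by auto
  have "n = \<one>" if n: "n \<in> ?P" for n
  proof (rule eq_by_action)
    show nG: "n \<in> carrier G" "\<one> \<in> carrier G" using n by auto
    fix j assume j: "j \<in> E"
    obtain g where g: "g \<in> carrier G" "\<phi> g i = j"
      using unique_orbit[OF i(1) j] by blast
    (* The conjugate of n in brackets lies in the core again, so it fixes i. *)
    have "n \<otimes> g = g \<otimes> (inv g \<otimes> n \<otimes> g)"
      using nG(1) g(1) by (simp add: m_assoc[symmetric])
    then have "\<phi> n j = \<phi> g (\<phi> (inv g \<otimes> n \<otimes> g) i)"
      using composition_rule[OF i(1)] nG(1) g by (metis inv_closed m_closed)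
    also have "\<dots> = j"
      using i(2)[OF P.inv_op_closed1[OF g(1) n]] g(2) by simp
    finally show "\<phi> n j = \<phi> \<one> j" using j by simp
  qed
  then show ?thesis using P.one_closed by blast
qed

section \<open>Commuting \<open>p\<close>-elements\<close>


text \<open>The cyclic subgroup generated by a central \<open>p\<close>-element is a normal \<open>p\<close>-subgroup.\<close>

lemma (in group) central_p_element_in_p_core:
  assumes p: "Factorial_Ring.prime p" and G: "finite (carrier G)"
    and z: "z \<in> carrier G" "z [^] (p ^ a) = \<one>"
    and central: "\<And>g. g \<in> carrier G \<Longrightarrow> z \<otimes> g = g \<otimes> z"
  shows "z \<in> p_core p G"
proof -
  let ?Z = "generate G {z}"
  have sZ: "subgroup ?Z G" using z(1) by (simp add: generate_is_subgroup)
  have "g \<otimes> h \<otimes> inv g = h" if g: "g \<in> carrier G" and h: "h \<in> ?Z" for g h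
  proof -
    obtain n :: nat where "h = z [^] n"
      using h generate_pow_on_finite_carrier[OF G z(1)] by auto
    then have "g \<otimes> h = h \<otimes> g" and "h \<in> carrier G"
      using group_commutes_pow[OF central[OF g] z(1) g] z(1) by simp_all
    then show ?thesis using g by (simp add: m_assoc)
  qed
  then have "?Z \<lhd> G"
    using sZ by (simp add: normal_inv_iff)
  moreover have "ord z dvd p ^ a"
    using z by (simp add: pow_eq_id)
  then have "p_group p (G\<lparr>carrier := ?Z\<rparr>)"
    using p generate_pow_card[OF z(1)] subgroup_imp_group[OF sZ]
    by (auto simp: p_group_def order_def divides_primepow_nat)
  ultimately have "?Z \<subseteq> p_core p G"
    using p_core_greatest(2)[OF is_group G p] by (simp add: normal_p_subgroup_def)
  then show ?thesis using generate.incl[of z "{z}" G] by auto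
qed

text \<open>Each generator commutes with all generators, hence is central in the generated subgroup
  and lies in its \<open>p\<close>-core. So the \<open>p\<close>-core contains a generating set and is the whole
  subgroup. Passing through the \<open>p\<close>-core replaces a computation of the order of a product of cyclic
  groups.\<close>

lemma (in group) commuting_p_elements_generate_p_group:
  assumes p: "Factorial_Ring.prime p" and G: "finite (carrier G)" and S: "S \<subseteq> carrier G"
    and p_elements: "\<And>s. s \<in> S \<Longrightarrow> \<exists>a. s [^] (p ^ a :: nat) = \<one>"
    and commute: "\<And>s t. s \<in> S \<Longrightarrow> t \<in> S \<Longrightarrow> s \<otimes> t = t \<otimes> s"
  shows "p_group p (subgroup_generated G S)"
proof -
  let ?K = "subgroup_generated G S"
  interpret K: group ?K by simp
  have fK: "finite (carrier ?K)"
    using carrier_subgroup_generated_subset G by (rule finite_subset)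
  have SK: "S \<subseteq> carrier ?K"
    by (rule subgroup_generated_subset_carrier_subset[OF S])
  have "s \<in> p_core p ?K" if s: "s \<in> S" for s
  proof -
    have sG: "s \<in> carrier G" using s S by auto
    (* The centralizer of s is a subgroup that contains S, hence all of K. *)
    have "subgroup {g \<in> carrier G. s \<otimes> g = g \<otimes> s} G"
    proof (rule subgroupI)
      fix g assume g: "g \<in> {g \<in> carrier G. s \<otimes> g = g \<otimes> s}"
      then have gG: "g \<in> carrier G" by simp
      have "g \<otimes> (s \<otimes> inv g) = (g \<otimes> s) \<otimes> inv g"
        using g sG by (simp add: m_assoc)
      also have "\<dots> = (s \<otimes> g) \<otimes> inv g"
        using g by simp
      also have "\<dots> = s"
        using gG sG by (simp add: m_assoc)
      finally show "inv g \<in> {g \<in> carrier G. s \<otimes> g = g \<otimes> s}"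
        using g sG by (simp add: inv_solve_left)
    next
      fix g h
      assume g: "g \<in> {g \<in> carrier G. s \<otimes> g = g \<otimes> s}"
        and h: "h \<in> {g \<in> carrier G. s \<otimes> g = g \<otimes> s}"
      have "s \<otimes> (g \<otimes> h) = g \<otimes> (s \<otimes> h)"
        using g h sG by (simp add: m_assoc[of s g h, symmetric] m_assoc[of g s h])
      then show "g \<otimes> h \<in> {g \<in> carrier G. s \<otimes> g = g \<otimes> s}"
        using g h sG by (simp add: m_assoc)
    qed (use sG in auto)
    then have "carrier ?K \<subseteq> {g \<in> carrier G. s \<otimes> g = g \<otimes> s}"
      using commute s S by (intro subgroup_generated_minimal) auto
    then have central: "s \<otimes>\<^bsub>?K\<^esub> g = g \<otimes>\<^bsub>?K\<^esub> s" if "g \<in> carrier ?K" for g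
      using that by auto
    obtain a where a: "s [^] (p ^ a) = \<one>"
      using p_elements[OF s] by blast
    show ?thesis
      by (rule K.central_p_element_in_p_core[OF p fK _ _ central, where a = a])
        (use s SK a in \<open>auto simp: pow_subgroup_generated\<close>)
  qed
  then have "S \<subseteq> p_core p ?K" by blast
  have core: "p_core p ?K \<lhd> ?K" "p_group p (?K\<lparr>carrier := p_core p ?K\<rparr>)"
    using p_core_greatest(1)[OF K.is_group fK p] by (auto simp: normal_p_subgroup_def)
  have "carrier (subgroup_generated ?K S) \<subseteq> p_core p ?K"
    by (rule K.subgroup_generated_minimal[OF normal_imp_subgroup[OF core(1)]]) fact
  then have "p_core p ?K = carrier ?K"
    using subgroup.subset[OF normal_imp_subgroup[OF core(1)]] by simp
  then show ?thesis
    using core(2) by (simp add: p_group_def order_def)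
qed

section \<open>Elements of small support\<close>

text \<open>The sets \<open>A\<close> and \<open>B\<close> contain the supports of \<open>x\<close> and \<open>y\<close>. Each of the two elements maps its
  own set into itself and fixes the other set pointwise.\<close>

lemma (in faithful_action) disjoint_support_commute:
  assumes x: "x \<in> carrier G" and y: "y \<in> carrier G"
    and A: "\<And>i. i \<in> E \<Longrightarrow> i \<notin> A \<Longrightarrow> \<phi> x i = i"
    and B: "\<And>i. i \<in> E \<Longrightarrow> i \<notin> B \<Longrightarrow> \<phi> y i = i"
    and disj: "A \<inter> B = {}"
  shows "x \<otimes> y = y \<otimes> x"
proof -
  interpret group G
    using group_hom group_hom.axioms(1) by blast
  have stable: "\<phi> z i \<in> C" 
    if z: "z \<in> carrier G" and i: "i \<in> E" "i \<in> C"
      and C: "\<And>i. i \<in> E \<Longrightarrow> i \<notin> C \<Longrightarrow> \<phi> z i = i" for z i C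
    using inj_prop[OF z] C[of "\<phi> z i"] i action_closed[OF z i(1)] by (metis inj_onD)
  show ?thesis
  proof (rule eq_by_action)
    fix i assume i: "i \<in> E"
    have "\<phi> x (\<phi> y i) = \<phi> y (\<phi> x i)"
    proof (cases "i \<in> A")
      case True
      then have "\<phi> x i \<in> A" using stable[OF x i _ A] by blast
      then show ?thesis
        using True disj i x by (metis B action_closed disjoint_iff)
    next
      case False
      then have xi: "\<phi> x i = i" using A i by blast
      show ?thesis
      proof (cases "i \<in> B")
        case True
        then have "\<phi> y i \<in> B" using stable[OF y i _ B] by blast
        then show ?thesis
          using xi disj i y by (metis A action_closed disjoint_iff)
      next
        case False
        then show ?thesis using xi B i by simp
      qed
    qed
    then show "\<phi> (x \<otimes> y) i = \<phi> (y \<otimes> x) i"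
      using composition_rule[OF i] x y by simp
  qed (use x y in auto)
qed

text \<open>The conjugate of \<open>x\<close> by \<open>g\<close> moves only points of the preimage of \<open>S\<close> under \<open>g\<close>, which is
  disjoint from \<open>S\<close> by hypothesis.\<close>

lemma (in faithful_action) support_moved_off_in_Lambda:
  assumes p: "Factorial_Ring.prime p" and G: "finite (carrier G)"
    and x: "x \<in> carrier G" "x [^] (p ^ a) = \<one>"
    and S: "S \<subseteq> E" "\<And>i. i \<in> E \<Longrightarrow> i \<notin> S \<Longrightarrow> \<phi> x i = i"
    and g: "g \<in> carrier G" "\<And>i. i \<in> S \<Longrightarrow> \<phi> g i \<notin> S"
  shows "g \<in> Lambda G p x"
proof -
  interpret group G
    using group_hom group_hom.axioms(1) by blast
  let ?y = "conj_by G x g"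
  have y: "?y \<in> carrier G" using x g by (simp add: conj_by_def)
  have act: "\<phi> ?y i = \<phi> (inv g) (\<phi> x (\<phi> g i))" if i: "i \<in> E" for i
    using composition_rule[OF i] composition_rule[of "\<phi> g i"] i x(1) g(1)
    by (simp add: conj_by_def)
  have fix_y: "\<phi> ?y i = i" if i: "i \<in> E" and "i \<notin> {i \<in> E. \<phi> g i \<in> S}" for i
    using that act[OF i] S(2) g(1) orbit_sym_aux[OF g(1) i] by auto
  have comm: "x \<otimes> ?y = ?y \<otimes> x"
  proof (rule disjoint_support_commute[OF x(1) y, of S "{i \<in> E. \<phi> g i \<in> S}"])
    show "S \<inter> {i \<in> E. \<phi> g i \<in> S} = {}" using g(2) by blast
  qed (use S(2) fix_y in blast)+
  have cancel: "g \<otimes> (inv g \<otimes> z) = z" if "z \<in> carrier G" for z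
    using that g(1) by (simp flip: m_assoc)
  have "(inv g \<otimes> x \<otimes> g) [^] (n::nat) = inv g \<otimes> x [^] n \<otimes> g" for n
  proof (induction n)
    case (Suc n)
    then show ?case
      using x(1) g(1) by (simp add: m_assoc cancel)
  qed (use g in simp)
  then have "?y [^] (p ^ a) = \<one>"
    using x g by (simp add: conj_by_def)
  then have "p_group p (subgroup_generated G {x, ?y})"
    using x y comm by (intro commuting_p_elements_generate_p_group[OF p G]) auto
  then show ?thesis using g by (simp add: Lambda_def)
qed

text \<open>The elements that send \<open>i\<close> to \<open>j\<close> form a left coset of the stabilizer of \<open>i\<close>.\<close>

lemma (in transitive_action) card_transporter:
  assumes G: "finite (carrier G)" and i: "i \<in> E" and j: "j \<in> E"
  shows "card {g \<in> carrier G. \<phi> g i = j} * card E = order G"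
proof -
  interpret group G
    using group_hom group_hom.axioms(1) by blast
  obtain h where h: "h \<in> carrier G" "\<phi> h i = j"
    using unique_orbit[OF i j] by blast
  have "bij_betw (\<lambda>g. h \<otimes> g) (stabilizer G \<phi> i) {g \<in> carrier G. \<phi> g i = j}"
  proof (rule bij_betw_byWitness[where f' = "\<lambda>g. inv h \<otimes> g"])
    show "(\<otimes>) h ` stabilizer G \<phi> i \<subseteq> {g \<in> carrier G. \<phi> g i = j}"
      using h composition_rule[OF i] by (auto simp: stabilizer_def)
    show "(\<otimes>) (inv h) ` {g \<in> carrier G. \<phi> g i = j} \<subseteq> stabilizer G \<phi> i"
      using h composition_rule[OF i] orbit_sym_aux[OF h(1) i h(2)] by (auto simp: stabilizer_def)
  qed (use h in \<open>auto simp: stabilizer_def m_assoc[symmetric]\<close>)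
  then have "card {g \<in> carrier G. \<phi> g i = j} = card (stabilizer G \<phi> i)"
    by (simp add: bij_betw_same_card)
  moreover have "orbit G \<phi> i = E"
    using unique_orbit[OF i] action_closed i by (auto simp: orbit_def)
  ultimately show ?thesis
    using orbit_stabilizer_theorem[OF i] by (simp add: mult.commute)
qed

text \<open>A union bound over the pairs of points of \<open>S\<close>: an element outside \<open>\<Lambda>\<close> sends some point of
  \<open>S\<close> to a point of \<open>S\<close>.\<close>

lemma (in faithful_transitive_action) card_outside_Lambda:
  assumes p: "Factorial_Ring.prime p" and G: "finite (carrier G)" and E: "finite E"
    and x: "x \<in> carrier G" "x [^] (p ^ a) = \<one>"
    and S: "S \<subseteq> E" "\<And>i. i \<in> E \<Longrightarrow> i \<notin> S \<Longrightarrow> \<phi> x i = i"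
  shows "card (carrier G - Lambda G p x) * card E \<le> (card S)\<^sup>2 * order G"
proof -
  let ?T = "\<lambda>(i, j). {g \<in> carrier G. \<phi> g i = j}"
  have fS: "finite S" using S(1) E by (rule finite_subset)
  have "carrier G - Lambda G p x \<subseteq> \<Union> (?T ` (S \<times> S))"
  proof
    fix g assume g: "g \<in> carrier G - Lambda G p x"
    then obtain i where "i \<in> S" "\<phi> g i \<in> S"
      using support_moved_off_in_Lambda[OF p G x S, of g] by auto
    then show "g \<in> \<Union> (?T ` (S \<times> S))" using g by auto
  qed
  moreover have "finite (\<Union> (?T ` (S \<times> S)))" 
    using G by (rule finite_subset[rotated]) auto
  ultimately have "card (carrier G - Lambda G p x) \<le> card (\<Union> (?T ` (S \<times> S)))"
    by (rule card_mono[rotated])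
  also have "\<dots> \<le> (\<Sum>ij\<in>S \<times> S. card (?T ij))"
    using fS by (intro card_UN_le) auto
  finally have "card (carrier G - Lambda G p x) * card E \<le> (\<Sum>ij\<in>S \<times> S. card (?T ij)) * card E"
    by (rule mult_right_mono) simp
  also have "\<dots> = (\<Sum>ij\<in>S \<times> S. order G)"
    unfolding sum_distrib_right using S(1) card_transporter[OF G] by (intro sum.cong) auto
  also have "\<dots> = (card S)\<^sup>2 * order G"
    by (simp add: card_cartesian_product power2_eq_square)
  finally show ?thesis .
qed

section \<open>Symmetric groups\<close>

lemma (in group_action) action_nat_pow:
  assumes "x \<in> carrier G" and "i \<in> E"
  shows "\<phi> (x [^] n) i = (\<phi> x ^^ n) i"
proof -
  interpret group G
    using group_hom group_hom.axioms(1) by blast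
  show ?thesis
    using assms(2)
    by (induction n arbitrary: i)
      (use assms(1) in \<open>simp_all add: composition_rule funpow_swap1[symmetric]\<close>)
qed

text \<open>Elements of a symmetric group are functions; this lemma moves such a group to one whose
  elements are natural numbers, and the isomorphism then serves as the action.\<close>

lemma finite_group_nat_copy:
  assumes "group H" and "finite (carrier H)"
  obtains G :: "nat monoid" and h where "group G" and "h \<in> iso G H"
proof -
  interpret group H by fact
  obtain f :: "'a \<Rightarrow> nat" where f: "inj_on f (carrier H)"
    using finite_imp_inj_to_nat_seg[OF assms(2)] by blast
  have iso: "f \<in> iso H (image_group f H)"
    by (rule inj_imp_image_group_iso[OF f])
  have "group (image_group f H)"
    using iso_imp_img_group[OF iso] by (simp add: image_group_def)
  then show thesis
    using that iso_set_sym[OF iso] by blast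
qed

lemma symmetric_group_nat_action:
  fixes n :: nat
  obtains G :: "nat monoid" and \<phi> where "finite (carrier G)"
    and "faithful_transitive_action G {..<n} \<phi>" and "\<phi> ` carrier G = Bij {..<n}"
proof -
  have "Bij {..<n} \<subseteq> {..<n} \<rightarrow>\<^sub>E {..<n}"
    by (auto simp: Bij_def bij_betw_def PiE_def)
  then have fin: "finite (Bij {..<n})"
    by (rule finite_subset) (simp add: finite_PiE)
  then have fin': "finite (carrier (BijGroup {..<n}))" by (simp add: BijGroup_def)
  obtain G :: "nat monoid" and \<phi> where G: "group G" and iso: "\<phi> \<in> iso G (BijGroup {..<n})"
    by (rule finite_group_nat_copy[OF group_BijGroup fin'])
  have bij: "bij_betw \<phi> (carrier G) (Bij {..<n})"
    using iso by (simp add: iso_def BijGroup_def)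
  have img: "\<phi> ` carrier G = Bij {..<n}" using bij by (simp add: bij_betw_def)
  have act: "group_action G {..<n} \<phi>"
    using G iso by (simp add: group_action_def group_hom_def group_hom_axioms_def iso_def group_BijGroup)
  have "\<exists>g\<in>carrier G. \<phi> g i = j" if ij: "i \<in> {..<n}" "j \<in> {..<n}" for i j
  proof -
    have "transpose i j permutes {..<n}" using ij by (simp add: permutes_swap_id)
    then have "restrict (transpose i j) {..<n} \<in> Bij {..<n}"
      by (simp add: Bij_def permutes_imp_bij cong: bij_betw_cong del: restrict_apply)
    then obtain g where "g \<in> carrier G" "\<phi> g = restrict (transpose i j) {..<n}"
      using img by (metis imageE)
    then show ?thesis using ij by (intro bexI[of _ g]) simp_all
  qed
  then have "faithful_transitive_action G {..<n} \<phi>"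
    using act bij
    by (simp add: faithful_transitive_action_def faithful_action_def faithful_action_axioms_def
        transitive_action_def transitive_action_axioms_def bij_betw_def)
  moreover have "finite (carrier G)"
    using bij fin by (simp add: bij_betw_finite)
  ultimately show thesis using that img by blast
qed

text \<open>The cycle \<open>0 \<mapsto> 1 \<mapsto> \<dots> \<mapsto> q - 1 \<mapsto> 0\<close>, written with \<open>mod\<close> so that its powers have the
  closed form below.\<close>

definition initial_cycle :: "nat \<Rightarrow> nat \<Rightarrow> nat" where
  "initial_cycle q i = (if i < q then (i + 1) mod q else i)"

lemma initial_cycle_funpow:
  "(initial_cycle q ^^ m) i = (if i < q then (i + m) mod q else i)"
  by (induction m) (auto simp: initial_cycle_def mod_Suc_eq)

text \<open>Injectivity holds because the \<open>q\<close>-th power is the identity; an injective self-map of a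
  finite set is onto.\<close>

lemma bij_betw_initial_cycle:
  assumes "q \<le> n"
  shows "bij_betw (initial_cycle q) {..<n} {..<n}"
proof -
  have "initial_cycle q i < n" if "i < n" for i
    using that assms mod_less_divisor[of q "Suc i"]
    by (cases "i < q") (auto simp: initial_cycle_def simp del: mod_less_divisor)
  moreover have "inj (initial_cycle q)"
  proof (cases "q = 0")
    case False
    have "(initial_cycle q ^^ q) = id"
      by (auto simp: initial_cycle_funpow fun_eq_iff)
    then have "(initial_cycle q ^^ (q - 1)) \<circ> initial_cycle q = id"
      using False by (metis Suc_diff_1 funpow_Suc_right neq0_conv)
    then show ?thesis by (metis inj_on_id inj_on_imageI2)
  qed (auto simp: initial_cycle_def inj_def)
  ultimately have "initial_cycle q ` {..<n} \<subseteq> {..<n}" and inj: "inj_on (initial_cycle q) {..<n}"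
    by (auto intro: inj_on_subset)
  then show ?thesis
    by (simp add: bij_betw_def endo_inj_surj)
qed

lemma ord_of_initial_cycle:
  fixes G (structure) and E :: "nat set"
  assumes "faithful_action G E \<phi>" and x: "x \<in> carrier G" and q: "0 < q" "{..<q} \<subseteq> E"
    and act: "\<And>i. i \<in> E \<Longrightarrow> \<phi> x i = initial_cycle q i"
  shows "group.ord G x = q"
proof -
  interpret faithful_action G E \<phi> by fact
  interpret group G
    using group_hom group_hom.axioms(1) by blast
  have pow: "\<phi> (x [^] m) i = (if i < q then (i + m) mod q else i)" if "i \<in> E" for m i
  proof -
    have "(\<phi> x ^^ m) i \<in> E \<and> (\<phi> x ^^ m) i = (initial_cycle q ^^ m) i"
      using that x by (induction m) (auto simp flip: act)
    then show ?thesis using action_nat_pow[OF x that] by (simp add: initial_cycle_funpow)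
  qed
  have "x [^] m = \<one> \<longleftrightarrow> q dvd m" for m :: nat
  proof
    assume "x [^] m = \<one>"
    (* The m-th power sends 0 to m mod q. *)
    then show "q dvd m" using pow[of 0 m] q by (auto simp: dvd_eq_mod_eq_0)
  next
    assume "q dvd m"
    then show "x [^] m = \<one>"
      using x pow[of _ m] by (intro eq_by_action) auto
  qed
  then show ?thesis
    using pow_eq_id[OF x] by (metis dvd_antisym dvd_refl)
qed

theorem theorem12:
  fixes \<eta> :: real and t p :: nat
  assumes "0 < \<eta>" and "\<eta> < 1" and "1 \<le> t" and "Factorial_Ring.prime p"
  shows "\<exists>G :: nat monoid. group G \<and> finite (carrier G) \<and> p_core p G = {\<one>\<^bsub>G\<^esub>} \<and>
    (\<exists>x \<in> carrier G. group.ord G x = p ^ t \<and>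
      real (card (Lambda G p x)) \<ge> \<eta> * real (card (carrier G)))"
proof -
  define q where "q = p ^ t"
  have q: "0 < q" using assms(4) by (simp add: q_def prime_gt_0_nat)
  obtain N :: nat where N: "real N \<ge> (real q)\<^sup>2 / (1 - \<eta>)"
    using real_arch_simple by blast
  (* N makes n large enough for the union bound, the summand q makes room for the cycle, and the
     form of n excludes divisibility by p. *)
  define n where "n = p * (N + q) + 1"
  have Nqn: "N + q \<le> n"
  proof -
    have "1 \<le> p" using prime_gt_0_nat[OF assms(4)] by simp
    then have "1 * (N + q) \<le> p * (N + q)" by (rule mult_le_mono1)
    then show ?thesis unfolding n_def by (metis le_add1 le_trans mult_1)
  qed
  have "\<not> p dvd n"
    using assms(4) unfolding n_def by (simp only: dvd_add_right_iff dvd_triv_left) auto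
  obtain G :: "nat monoid" and \<phi> where G: "finite (carrier G)"
    and "faithful_transitive_action G {..<n} \<phi>" and img: "\<phi> ` carrier G = Bij {..<n}"
    by (rule symmetric_group_nat_action)
  interpret faithful_transitive_action G "{..<n}" \<phi> by fact
  interpret group G
    using group_hom group_hom.axioms(1) by blast
  have "restrict (initial_cycle q) {..<n} \<in> Bij {..<n}"
    using bij_betw_initial_cycle[of q n] Nqn
    by (simp add: Bij_def cong: bij_betw_cong del: restrict_apply)
  then obtain x where x: "x \<in> carrier G" "\<phi> x = restrict (initial_cycle q) {..<n}"
    using img by (metis imageE)
  have ord: "group.ord G x = p ^ t"
    unfolding q_def[symmetric] using x q Nqn
    by (intro ord_of_initial_cycle[OF faithful_action_axioms]) auto
  then have "x [^]\<^bsub>G\<^esub> (p ^ t) = \<one>\<^bsub>G\<^esub>" using pow_ord_eq_1[OF x(1)] by simp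
  then have "card (carrier G - Lambda G p x) * card {..<n} \<le> (card {..<q})\<^sup>2 * order G"
    using x Nqn
    by (intro card_outside_Lambda[OF assms(4) G]) (auto simp: initial_cycle_def)
  then have "real (card (carrier G - Lambda G p x)) * real n \<le> (real q)\<^sup>2 * real (order G)"
    by (simp flip: of_nat_mult of_nat_power)
  also have "(real q)\<^sup>2 \<le> (1 - \<eta>) * real n"
  proof -
    have "(real q)\<^sup>2 \<le> (1 - \<eta>) * real N" using N assms(2) by (simp add: field_simps)
    also have "\<dots> \<le> (1 - \<eta>) * real n" using Nqn assms(2) by (intro mult_left_mono) auto
    finally show ?thesis .
  qed
  then have "(real q)\<^sup>2 * real (order G) \<le> (1 - \<eta>) * real n * real (order G)"
    by (rule mult_right_mono) simp
  finally have "real (card (carrier G - Lambda G p x)) \<le> (1 - \<eta>) * real (order G)"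
    using Nqn q by (simp add: mult.commute mult.left_commute)
  moreover have "Lambda G p x \<subseteq> carrier G" by (auto simp: Lambda_def)
  then have "real (card (carrier G - Lambda G p x)) = real (order G) - real (card (Lambda G p x))"
    using G by (simp add: card_Diff_subset finite_subset order_def card_mono of_nat_diff)
  ultimately have "real (card (Lambda G p x)) \<ge> \<eta> * real (card (carrier G))"
    by (simp add: order_def algebra_simps)
  moreover have "p_core p G = {\<one>\<^bsub>G\<^esub>}"
    using \<open>\<not> p dvd n\<close> by (intro p_core_trivial[OF assms(4) G]) auto
  ultimately show ?thesis
    using G x(1) ord is_group by blast
qed

end
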